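(* Let $t\ge 5$ be an odd integer and let $d$ be an integer with $d\ge t-3$. Then $$\chi_d(G_t)=1+t\left(d-\frac{t-3}{2}\right).$$
   Context: For an odd integer $t\ge 3$, $G_t$ denotes the integer distance graph $G(\mathbb{Z},\{2,t\})$: its vertex set is $\mathbb{Z}$, and distinct $i,j\in\mathbb{Z}$ are adjacent if and only if $|i-j|\in\{2,t\}$. For a graph $G$ and a positive integer $d$, a $d$-distance $k$-coloring is a map $f:V(G)\to\{1,\ldots,k\}$ such that any two distinct vertices $u,v$ with $f(u)=f(v)$ satisfy $d_G(u,v)>d$ ($d_G$ the shortest-path distance); $\chi_d(G)$ is the smallest such $k$. *)

theory Defs
  imports Main "HOL-Library.Extended_Nat"
begin

text \<open>
  A graph is given by its adjacency relation; its vertex set is the whole underlying type.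
\<close>

definition graph_path :: "('a \<Rightarrow> 'a \<Rightarrow> bool) \<Rightarrow> 'a list \<Rightarrow> bool" where
  "graph_path adj xs \<longleftrightarrow> xs \<noteq> [] \<and> distinct xs \<and> successively adj xs"

text \<open>
  A path with list of vertices \<open>xs\<close> has \<open>length xs - 1\<close> edges. Vertices not joined by a path
  are at distance \<open>\<infinity>\<close>, the infimum of the empty set.
\<close>

definition graph_dist :: "('a \<Rightarrow> 'a \<Rightarrow> bool) \<Rightarrow> 'a \<Rightarrow> 'a \<Rightarrow> enat" where
  "graph_dist adj u v =
     Inf {enat (length xs - 1) | xs. graph_path adj xs \<and> hd xs = u \<and> last xs = v}"

definition distance_coloring ::
    "('a \<Rightarrow> 'a \<Rightarrow> bool) \<Rightarrow> nat \<Rightarrow> nat \<Rightarrow> ('a \<Rightarrow> nat) \<Rightarrow> bool" where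
  "distance_coloring adj d k f \<longleftrightarrow>
     (\<forall>v. f v \<in> {1..k}) \<and>
     (\<forall>u v. u \<noteq> v \<and> f u = f v \<longrightarrow> graph_dist adj u v > enat d)"

text \<open>
  The value is \<open>\<infinity>\<close> if no finite number of colours suffices; otherwise the infimum is attained.
\<close>

definition distance_chromatic_number :: "('a \<Rightarrow> 'a \<Rightarrow> bool) \<Rightarrow> nat \<Rightarrow> enat" where
  "distance_chromatic_number adj d = Inf {enat k | k. \<exists>f. distance_coloring adj d k f}"

definition integer_distance_graph :: "int set \<Rightarrow> int \<Rightarrow> int \<Rightarrow> bool" where
  "integer_distance_graph D i j \<longleftrightarrow> i \<noteq> j \<and> \<bar>i - j\<bar> \<in> D"

definition G :: "nat \<Rightarrow> int \<Rightarrow> int \<Rightarrow> bool" where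
  "G t = integer_distance_graph {2, int t}"

end

theory Submission
  imports Defs
begin

text \<open>
  Write \<open>q = (t - 3) / 2\<close> and \<open>D = d - q\<close>. Vertices \<open>u\<close>, \<open>v\<close> are within distance \<open>d\<close> iff
  \<open>v - u = 2 a + t b\<close> with \<open>\<bar>a\<bar> + \<bar>b\<bar> \<le> d\<close>. No nonzero multiple of \<open>1 + t D\<close> has such a
  representation, so the residues modulo \<open>1 + t D\<close> give a coloring. Conversely, all of
  \<open>1, \<dots>, t D\<close> have one as soon as \<open>D \<ge> 2\<close>, so \<open>{0..t D}\<close> needs pairwise distinct colors.
  The hypothesis \<open>d \<ge> t - 3\<close> leaves only \<open>t = 5\<close>, \<open>d = 2\<close> with \<open>D < 2\<close>; there consecutive
  integers may share a color, so with only five colors some \<open>x\<close> and \<open>x + 1\<close> do. Every closed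
  neighborhood is a clique of five vertices and hence shows all five colors; but the color of
  \<open>x + 2\<close> turns out to be missing from the neighborhood of \<open>x + 3\<close>.
\<close>

section \<open>Distance colorings\<close>

lemma relpowp_imp_graph_path:
  assumes "(adj ^^ n) u v"
  shows "\<exists>xs. graph_path adj xs \<and> hd xs = u \<and> last xs = v \<and> length xs - 1 \<le> n"
  using assms
proof (induction n arbitrary: u)
  case 0
  then show ?case by (intro exI[of _ "[u]"]) (auto simp: graph_path_def)
next
  case (Suc n)
  obtain w where "adj u w" and "(adj ^^ n) w v"
    using Suc.prems by (meson relpowp_Suc_D2)
  then obtain xs where path: "xs \<noteq> []" "distinct xs" "successively adj xs"
    and ends: "hd xs = w" "last xs = v" and length: "length xs - 1 \<le> n"
    using Suc.IH by (auto simp: graph_path_def)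
  show ?case
  proof (cases "u \<in> set xs")
    case True
    then obtain ys zs where "xs = ys @ u # zs" by (meson split_list)
    then show ?thesis
      using path ends length
      by (intro exI[of _ "u # zs"]) (auto simp: graph_path_def successively_append_iff)
  next
    case False
    then show ?thesis
      using path ends length \<open>adj u w\<close>
      by (intro exI[of _ "u # xs"]) (auto simp: graph_path_def successively_Cons)
  qed
qed

lemma successively_imp_relpowp:
  assumes "xs \<noteq> []" and "successively adj xs"
  shows "(adj ^^ (length xs - 1)) (hd xs) (last xs)"
  using assms
proof (induction xs rule: induct_list012)
  case (3 x y zs)
  then have "adj x y" and "(adj ^^ length zs) y (last (y # zs))" by auto
  then have "(adj ^^ Suc (length zs)) x (last (y # zs))" by (rule relpowp_Suc_I2)
  then show ?case by (simp del: relpowp.simps)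
qed auto

lemma graph_dist_le_iff_graph_path:
  "graph_dist adj u v \<le> enat d \<longleftrightarrow>
    (\<exists>xs. graph_path adj xs \<and> hd xs = u \<and> last xs = v \<and> length xs - 1 \<le> d)"
proof -
  have "graph_dist adj u v \<le> enat d \<longleftrightarrow> graph_dist adj u v < enat (Suc d)"
    by (cases "graph_dist adj u v") auto
  then show ?thesis by (auto simp: graph_dist_def Inf_less_iff less_Suc_eq_le)
qed

lemma graph_dist_le_iff_relpowp:
  "graph_dist adj u v \<le> enat d \<longleftrightarrow> (\<exists>n\<le>d. (adj ^^ n) u v)"
proof
  assume "graph_dist adj u v \<le> enat d"
  then show "\<exists>n\<le>d. (adj ^^ n) u v"
    using successively_imp_relpowp[of _ adj]
    by (auto simp: graph_dist_le_iff_graph_path graph_path_def)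
next
  assume "\<exists>n\<le>d. (adj ^^ n) u v"
  then show "graph_dist adj u v \<le> enat d"
    using relpowp_imp_graph_path[of _ adj u v] order_trans
    unfolding graph_dist_le_iff_graph_path by blast
qed

lemma distance_coloring_iff_graph_dist_le:
  "distance_coloring adj d k f \<longleftrightarrow>
    range f \<subseteq> {1..k} \<and> (\<forall>u v. u \<noteq> v \<and> graph_dist adj u v \<le> enat d \<longrightarrow> f u \<noteq> f v)"
  unfolding distance_coloring_def image_subset_iff not_le[symmetric] by blast

lemma distance_chromatic_number_eqI:
  assumes "distance_coloring adj d k f"
    and "\<And>k' f'. distance_coloring adj d k' f' \<Longrightarrow> k \<le> k'"
  shows "distance_chromatic_number adj d = enat k"
  unfolding distance_chromatic_number_def using assms
  by (intro antisym Inf_lower Inf_greatest) auto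

section \<open>Short integer combinations\<close>

definition l1_combinations :: "int \<Rightarrow> int \<Rightarrow> nat \<Rightarrow> int set" where
  "l1_combinations s t n = {s * a + t * b | a b. \<bar>a\<bar> + \<bar>b\<bar> \<le> int n}"

lemma l1_combinationsI:
  assumes "x = s * a + t * b" and "\<bar>a\<bar> + \<bar>b\<bar> \<le> int n"
  shows "x \<in> l1_combinations s t n"
  using assms by (auto simp: l1_combinations_def)

lemma l1_combinationsE:
  assumes "x \<in> l1_combinations s t n"
  obtains a b where "x = s * a + t * b" and "\<bar>a\<bar> + \<bar>b\<bar> \<le> int n"
  using assms by (auto simp: l1_combinations_def)

lemma uminus_in_l1_combinations:
  assumes "x \<in> l1_combinations s t n"
  shows "- x \<in> l1_combinations s t n"
  using assms
proof (rule l1_combinationsE)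
  fix a b assume "x = s * a + t * b" "\<bar>a\<bar> + \<bar>b\<bar> \<le> int n"
  then show ?thesis by (intro l1_combinationsI[of _ s "- a" t "- b"]) auto
qed

lemma abs_in_l1_combinations_iff:
  "\<bar>x\<bar> \<in> l1_combinations s t n \<longleftrightarrow> x \<in> l1_combinations s t n"
  using uminus_in_l1_combinations[of x] uminus_in_l1_combinations[of "- x"] by (cases "x \<ge> 0") auto

lemma add_in_l1_combinations:
  assumes "x \<in> l1_combinations s t m" and "y \<in> l1_combinations s t n"
  shows "x + y \<in> l1_combinations s t (m + n)"
proof -
  obtain a b where x: "x = s * a + t * b" "\<bar>a\<bar> + \<bar>b\<bar> \<le> int m"
    using assms(1) by (rule l1_combinationsE)
  obtain a' b' where y: "y = s * a' + t * b'" "\<bar>a'\<bar> + \<bar>b'\<bar> \<le> int n"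
    using assms(2) by (rule l1_combinationsE)
  show ?thesis
  proof (rule l1_combinationsI)
    show "x + y = s * (a + a') + t * (b + b')" using x y by (simp add: algebra_simps)
    show "\<bar>a + a'\<bar> + \<bar>b + b'\<bar> \<le> int (m + n)" using x y by simp
  qed
qed

lemma l1_combinations_mono:
  assumes "m \<le> n"
  shows "l1_combinations s t m \<subseteq> l1_combinations s t n"
  using assms by (fastforce simp: l1_combinations_def)

lemma generator_in_l1_combinations:
  assumes "\<bar>x\<bar> \<in> {s, t}"
  shows "x \<in> l1_combinations s t 1"
proof -
  have "s \<in> l1_combinations s t 1" by (rule l1_combinationsI[of _ s 1 t 0]) auto
  moreover have "t \<in> l1_combinations s t 1" by (rule l1_combinationsI[of _ s 0 t 1]) auto
  ultimately have "\<bar>x\<bar> \<in> l1_combinations s t 1" using assms by auto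
  then show ?thesis by (simp only: abs_in_l1_combinations_iff)
qed

lemma abs_l1_combination_le:
  assumes "x \<in> l1_combinations s t n" and "\<bar>s\<bar> \<le> c" and "\<bar>t\<bar> \<le> c"
  shows "\<bar>x\<bar> \<le> c * int n"
proof -
  obtain a b where x: "x = s * a + t * b" and short: "\<bar>a\<bar> + \<bar>b\<bar> \<le> int n"
    using assms(1) by (rule l1_combinationsE)
  have "\<bar>x\<bar> \<le> \<bar>s\<bar> * \<bar>a\<bar> + \<bar>t\<bar> * \<bar>b\<bar>" unfolding x abs_mult[symmetric] by (rule abs_triangle_ineq)
  also have "\<dots> \<le> c * \<bar>a\<bar> + c * \<bar>b\<bar>" using assms(2,3) by (intro add_mono mult_right_mono) auto
  also have "\<dots> = c * (\<bar>a\<bar> + \<bar>b\<bar>)" by (simp add: distrib_left)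
  also have "\<dots> \<le> c * int n" using short assms(2) by (intro mult_left_mono) auto
  finally show ?thesis .
qed

lemma relpowp_integer_distance_graph_imp_diff:
  assumes "(integer_distance_graph {s, t} ^^ n) u v"
  shows "v - u \<in> l1_combinations s t n"
  using assms
proof (induction n arbitrary: v)
  case 0
  then show ?case by (intro l1_combinationsI[of _ s 0 t 0]) auto
next
  case (Suc n)
  then obtain w where "(integer_distance_graph {s, t} ^^ n) u w"
    and "integer_distance_graph {s, t} w v" by auto
  then have "w - u \<in> l1_combinations s t n" and "\<bar>v - w\<bar> \<in> {s, t}"
    using Suc.IH by (blast, simp add: integer_distance_graph_def abs_minus_commute)
  then have "(w - u) + (v - w) \<in> l1_combinations s t (n + 1)"
    by (intro add_in_l1_combinations generator_in_l1_combinations)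
  then show ?case by simp
qed

lemma relpowp_translation:
  fixes c :: "'a :: semiring_1"
  assumes "\<And>x. adj x (x + c)"
  shows "(adj ^^ n) u (u + of_nat n * c)"
proof (induction n)
  case (Suc n)
  have "adj (u + of_nat n * c) (u + of_nat n * c + c)" by (rule assms)
  with Suc have "(adj ^^ Suc n) u (u + of_nat n * c + c)" by auto
  then show ?case by (simp add: algebra_simps del: relpowp.simps)
qed simp

lemma relpowp_integer_distance_graph_multiple:
  assumes "\<bar>c\<bar> \<in> X" and "c \<noteq> 0"
  shows "(integer_distance_graph X ^^ nat \<bar>a\<bar>) u (u + c * a)"
proof -
  have adj: "integer_distance_graph X x (x + c)" "integer_distance_graph X x (x + - c)" for x
    using assms by (auto simp: integer_distance_graph_def)
  show ?thesis
    using relpowp_translation[of "integer_distance_graph X" c, OF adj(1)]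
      relpowp_translation[of "integer_distance_graph X" "- c", OF adj(2)]
    by (cases a rule: int_cases2) (fastforce simp: mult.commute)+
qed

lemma graph_dist_integer_distance_graph_le_iff:
  assumes "s > 0" and "t > 0"
  shows "graph_dist (integer_distance_graph {s, t}) u v \<le> enat d \<longleftrightarrow>
    v - u \<in> l1_combinations s t d"
proof
  assume "graph_dist (integer_distance_graph {s, t}) u v \<le> enat d"
  then show "v - u \<in> l1_combinations s t d"
    using relpowp_integer_distance_graph_imp_diff l1_combinations_mono
    unfolding graph_dist_le_iff_relpowp by blast
next
  assume "v - u \<in> l1_combinations s t d"
  then obtain a b where diff: "v - u = s * a + t * b" and short: "\<bar>a\<bar> + \<bar>b\<bar> \<le> int d"
    by (rule l1_combinationsE)
  have "(integer_distance_graph {s, t} ^^ nat \<bar>a\<bar>) u (u + s * a)"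
    and "(integer_distance_graph {s, t} ^^ nat \<bar>b\<bar>) (u + s * a) (u + s * a + t * b)"
    using assms by (auto intro!: relpowp_integer_distance_graph_multiple)
  then have "(integer_distance_graph {s, t} ^^ (nat \<bar>a\<bar> + nat \<bar>b\<bar>)) u (u + s * a + t * b)"
    unfolding relpowp_add by blast
  moreover have "u + s * a + t * b = v" using diff by simp
  moreover have "nat \<bar>a\<bar> + nat \<bar>b\<bar> \<le> d" using short by linarith
  ultimately show "graph_dist (integer_distance_graph {s, t}) u v \<le> enat d"
    by (auto simp: graph_dist_le_iff_relpowp)
qed

section \<open>Colorings separating a set of differences\<close>

definition separates_differences :: "'a :: ab_group_add set \<Rightarrow> ('a \<Rightarrow> 'c) \<Rightarrow> bool" where
  "separates_differences X f \<longleftrightarrow> (\<forall>u v. u \<noteq> v \<and> v - u \<in> X \<longrightarrow> f u \<noteq> f v)"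

lemma distance_coloring_integer_distance_graph_iff:
  assumes "s > 0" and "t > 0"
  shows "distance_coloring (integer_distance_graph {s, t}) d k f \<longleftrightarrow>
    range f \<subseteq> {1..k} \<and> separates_differences (l1_combinations s t d) f"
  by (simp add: distance_coloring_iff_graph_dist_le separates_differences_def
      graph_dist_integer_distance_graph_le_iff[OF assms])

lemma separates_differences_inj_on:
  fixes S :: "'a :: {linorder, ab_group_add} set"
  assumes "separates_differences X f"
    and "\<And>u v. u \<in> S \<Longrightarrow> v \<in> S \<Longrightarrow> u < v \<Longrightarrow> v - u \<in> X"
  shows "inj_on f S"
  using assms by (intro linorder_inj_onI) (auto simp: separates_differences_def)

lemma separates_differences_card_le:
  fixes S :: "'a :: {linorder, ab_group_add} set"
  assumes "separates_differences X f" and "finite C" and "range f \<subseteq> C"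
    and "\<And>u v. u \<in> S \<Longrightarrow> v \<in> S \<Longrightarrow> u < v \<Longrightarrow> v - u \<in> X"
  shows "card S \<le> card C"
  using separates_differences_inj_on[OF assms(1,4)] assms(2,3) by (intro card_inj_on_le) auto

definition residue_coloring :: "nat \<Rightarrow> int \<Rightarrow> nat" where
  "residue_coloring K v = nat (v mod int K) + 1"

lemma range_residue_coloring:
  assumes "K > 0"
  shows "range (residue_coloring K) \<subseteq> {1..K}"
  using assms by (auto simp: residue_coloring_def Suc_le_eq nat_less_iff)

lemma separates_differences_residue_coloring:
  assumes "K > 0" and "\<And>x. x \<in> X \<Longrightarrow> int K dvd x \<Longrightarrow> x = 0"
  shows "separates_differences X (residue_coloring K)"
  unfolding separates_differences_def
proof (intro allI impI notI)
  fix u v :: int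
  assume uv: "u \<noteq> v \<and> v - u \<in> X" and "residue_coloring K u = residue_coloring K v"
  then have "v mod int K = u mod int K"
    using \<open>K > 0\<close> by (simp add: residue_coloring_def eq_nat_nat_iff)
  then have "int K dvd v - u" by (simp add: mod_eq_dvd_iff)
  then have "v - u = 0" using assms(2) uv by blast
  with uv show False by simp
qed

section \<open>Combinations of 2 and an odd number\<close>

lemma one_plus_mult_notin_l1_combinations:
  fixes t q D :: nat
  assumes t: "t = 2 * q + 3"
  shows "1 + int t * int D \<notin> l1_combinations 2 (int t) (D + q)"
proof
  assume "1 + int t * int D \<in> l1_combinations 2 (int t) (D + q)"
  then obtain a b where "1 + int t * int D = 2 * a + int t * b"
    and short: "\<bar>a\<bar> + \<bar>b\<bar> \<le> int (D + q)"
    by (rule l1_combinationsE)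
  define e where "e = b - int D"
  have rep: "2 * a + int t * e = 1"
    using \<open>1 + int t * int D = 2 * a + int t * b\<close> by (simp add: e_def algebra_simps)
  then have "e \<noteq> 0" by auto presburger
  then consider (above) "e \<ge> 1" | (below) "e \<le> - 1" by linarith
  then show False
  proof cases
    case above
    then have "int t * 1 \<le> int t * e" by (intro mult_left_mono) auto
    then have "int q + 1 \<le> - a" using rep by (simp add: t algebra_simps)
    then show False using above short by (simp add: e_def)
  next
    case below
    then have "(int t - 2) * 1 \<le> (int t - 2) * (- e)" by (intro mult_left_mono) (auto simp: t)
    then have "int q + 1 \<le> a + e" using rep by (simp add: t algebra_simps)
    then show False using short by (simp add: e_def)
  qed
qed

lemma dvd_l1_combination_imp_zero:
  fixes t q D :: nat
  assumes t: "t = 2 * q + 3" and "q \<le> D"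
    and x: "x \<in> l1_combinations 2 (int t) (D + q)" and "int (1 + t * D) dvd x"
  shows "x = 0"
proof (rule ccontr)
  assume "x \<noteq> 0"
  define K where "K = 1 + int t * int D"
  have "K > 0" by (simp add: K_def add_pos_nonneg)
  obtain m where m: "x = K * m" using assms(4) by (auto simp: K_def)
  have "\<bar>x\<bar> \<le> int t * int (D + q)" using x by (rule abs_l1_combination_le) (auto simp: t)
  also have "\<dots> \<le> int t * (2 * int D)" using \<open>q \<le> D\<close> by (intro mult_left_mono) auto
  also have "\<dots> < K * 2" by (simp add: K_def)
  finally have "K * \<bar>m\<bar> < K * 2" using \<open>K > 0\<close> by (simp add: m abs_mult)
  then have "\<bar>m\<bar> < 2" using \<open>K > 0\<close> by (simp only: mult_less_cancel_left_pos)
  moreover have "m \<noteq> 0" using m \<open>x \<noteq> 0\<close> by auto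
  ultimately have "m = 1 \<or> m = - 1" by linarith
  then have "\<bar>x\<bar> = K" using m \<open>K > 0\<close> by auto
  then have "K \<in> l1_combinations 2 (int t) (D + q)"
    using x by (simp only: abs_in_l1_combinations_iff flip: \<open>\<bar>x\<bar> = K\<close>)
  then show False
    using one_plus_mult_notin_l1_combinations[OF t] unfolding K_def by blast
qed

lemma interval_subset_l1_combinations:
  fixes t q D :: nat
  assumes t: "t = 2 * q + 3" and "D \<ge> 2"
  shows "{0..int t * int D} \<subseteq> l1_combinations 2 (int t) (D + q)"
proof
  fix n assume n: "n \<in> {0..int t * int D}"
  define A s where "A = n div int t" and "s = n mod int t"
  have "int t > 0" by (simp add: t)
  have n_eq: "n = int t * A + s" by (simp add: A_def s_def)
  have s: "0 \<le> s" "s < int t" using \<open>int t > 0\<close> by (simp_all add: s_def)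
  have "0 \<le> A" using n \<open>int t > 0\<close> by (simp add: A_def pos_imp_zdiv_nonneg_iff)
  have "A \<le> int D"
    using zdiv_mono1[of n "int t * int D" "int t"] n \<open>int t > 0\<close> by (simp add: A_def)
  moreover have "s = 0" if "A = int D" using n n_eq s that by simp
  ultimately have A_le: "A < int D \<or> A = int D \<and> s = 0" by linarith
  consider (even) r where "s = 2 * r"
    | (odd_last) "s = 1" "A = int D - 1"
    | (odd) r where "s = 2 * r + 1" "r \<noteq> 0 \<or> A < int D - 1" "A < int D"
    using A_le by (cases "even s"; cases "s = 1 \<and> A = int D - 1")
      (fastforce elim!: evenE oddE)+
  then show "n \<in> l1_combinations 2 (int t) (D + q)"
  proof cases
    case even
    then show ?thesis
      using n_eq s \<open>0 \<le> A\<close> A_le by (intro l1_combinationsI[of _ _ r _ A]) (auto simp: t)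
  next
    case odd_last
    \<comment> \<open>Rounding up to the quotient \<open>A + 1 = D\<close> would cost \<open>D + q + 1\<close>.\<close>
    then show ?thesis
      using n_eq \<open>D \<ge> 2\<close>
      by (intro l1_combinationsI[of _ _ "int q + 2" _ "A - 1"]) (auto simp: t algebra_simps)
  next
    case odd
    then show ?thesis
      using n_eq s \<open>0 \<le> A\<close>
      by (intro l1_combinationsI[of _ _ "r - int q - 1" _ "A + 1"]) (auto simp: t algebra_simps)
  qed
qed

section \<open>The square of the graph with generators 2 and 5\<close>

lemma in_l1_combinations_2_5:
  assumes "\<bar>x\<bar> \<in> {2, 3, 4, 5, 7, 10}"
  shows "x \<in> l1_combinations 2 5 2"
proof -
  have "2 * 1 + 5 * 0 \<in> l1_combinations 2 5 2" "2 * (- 1) + 5 * 1 \<in> l1_combinations 2 5 2"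
    "2 * 2 + 5 * 0 \<in> l1_combinations 2 5 2" "2 * 0 + 5 * 1 \<in> l1_combinations 2 5 2"
    "2 * 1 + 5 * 1 \<in> l1_combinations 2 5 2" "2 * 0 + 5 * 2 \<in> l1_combinations 2 5 2"
    by (rule l1_combinationsI, rule refl, simp)+
  then have "\<bar>x\<bar> \<in> l1_combinations 2 5 2" using assms by auto
  then show ?thesis by (simp only: abs_in_l1_combinations_iff)
qed

definition closed_neighborhood_2_5 :: "int \<Rightarrow> int set" where
  "closed_neighborhood_2_5 c = {c - 5, c - 2, c, c + 2, c + 5}"

lemma card_image_insert_closed_neighborhood:
  assumes "separates_differences (l1_combinations 2 5 2) f"
    and "f y \<notin> f ` closed_neighborhood_2_5 c"
  shows "card (f ` insert y (closed_neighborhood_2_5 c)) = 6"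
proof -
  have "inj_on f (closed_neighborhood_2_5 c)"
    using assms(1)
    by (rule separates_differences_inj_on)
      (auto simp: closed_neighborhood_2_5_def intro: in_l1_combinations_2_5)
  then have "card (f ` closed_neighborhood_2_5 c) = card (closed_neighborhood_2_5 c)"
    by (rule card_image)
  also have "\<dots> = 5" by (simp add: closed_neighborhood_2_5_def)
  finally show ?thesis using assms(2) by (simp add: closed_neighborhood_2_5_def)
qed

lemma monochromatic_pair_imp_color_missing:
  assumes "separates_differences (l1_combinations 2 5 2) f" and pair: "f x = f (x + 1)"
  shows "\<exists>y c. f y \<notin> f ` closed_neighborhood_2_5 c"
proof (rule ccontr)
  assume "\<not> ?thesis"
  then have dominated: "f y \<in> {f (c - 5), f (c - 2), f c, f (c + 2), f (c + 5)}" for y c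
    by (auto simp: closed_neighborhood_2_5_def)
  have differ: "f u \<noteq> f v" if "\<bar>u - v\<bar> \<in> {2, 3, 4, 5, 7, 10}" for u v
    using that assms(1) in_l1_combinations_2_5[of "v - u"]
    by (auto simp: separates_differences_def abs_minus_commute)
  have "f (x + 8) \<in> {f (x + 7), f x}"
    using dominated[of "x + 8" "x + 5"] differ[of "x + 8"] by (auto simp: algebra_simps)
  then have pair_above: "f (x + 8) = f (x + 7)"
    using pair differ[of "x + 8" "x + 1"] by auto
  have "f (x - 7) \<in> {f (x - 6), f (x + 1)}"
    using dominated[of "x - 7" "x - 4"] differ[of "x - 7"] by (auto simp: algebra_simps)
  then have pair_below: "f (x - 7) = f (x - 6)"
    using pair differ[of "x - 7" x] by auto
  have "f (x + 2) \<in> {f (x + 1), f (x - 6)}"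
    using dominated[of "x + 2" "x - 1"] differ[of "x + 2"] by (auto simp: algebra_simps)
  then have "f (x + 2) = f (x - 7)"
    using pair pair_below differ[of "x + 2" x] by auto
  moreover have "f (x + 2) \<in> {f (x + 1), f (x + 3), f (x + 8)}"
    using dominated[of "x + 2" "x + 3"] differ[of "x + 2"] by (auto simp: algebra_simps)
  ultimately show False
    using pair pair_above differ[of "x + 2" x] differ[of "x + 3" "x - 7"] differ[of "x + 2" "x + 7"]
    by auto
qed

lemma separates_differences_2_5_card_ge:
  assumes separates: "separates_differences (l1_combinations 2 5 2) f"
    and S: "finite S" "range f \<subseteq> S"
  shows "6 \<le> card S"
proof -
  have "\<exists>T. card (f ` T) = 6"
  proof (cases "\<exists>x. f x = f (x + 1)")
    case True
    then show ?thesis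
      using monochromatic_pair_imp_color_missing[OF separates]
        card_image_insert_closed_neighborhood[OF separates] by metis
  next
    case False
    then have "separates_differences (insert 1 (l1_combinations 2 5 2)) f"
      using separates by (auto simp: separates_differences_def algebra_simps)
    then have "inj_on f {0..5}"
      by (rule separates_differences_inj_on) (auto intro: in_l1_combinations_2_5)
    then have "card (f ` {0..5}) = 6" by (simp add: card_image)
    then show ?thesis by blast
  qed
  then show ?thesis using S card_mono[of S] by (metis image_mono order_trans subset_UNIV)
qed

section \<open>The chromatic number\<close>

lemma separates_l1_combinations_card_ge:
  fixes t q D :: nat
  assumes t: "t = 2 * q + 3" and "1 \<le> q" and "q \<le> D"
    and separates: "separates_differences (l1_combinations 2 (int t) (D + q)) f"
    and C: "finite C" "range f \<subseteq> C"
  shows "1 + t * D \<le> card C"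
proof (cases "D \<ge> 2")
  case True
  have "card {0..int t * int D} \<le> card C"
    using separates C
  proof (rule separates_differences_card_le)
    fix u v
    assume "u \<in> {0..int t * int D}" "v \<in> {0..int t * int D}" "u < v"
    then have "v - u \<in> {0..int t * int D}" by auto
    then show "v - u \<in> l1_combinations 2 (int t) (D + q)"
      using interval_subset_l1_combinations[OF t True] by blast
  qed
  then show ?thesis by (simp add: nat_add_distrib nat_mult_distrib)
next
  case False
  with assms(2,3) have "q = 1" "D = 1" by auto
  then have "separates_differences (l1_combinations 2 5 2) f"
    using separates by (simp add: t numeral_2_eq_2)
  then have "6 \<le> card C" using C by (rule separates_differences_2_5_card_ge)
  then show ?thesis using \<open>q = 1\<close> \<open>D = 1\<close> by (simp add: t)
qed

theorem theorem8:
  fixes t d :: nat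
  assumes "odd t" and "t \<ge> 5" and "d \<ge> t - 3"
  shows "distance_chromatic_number (G t) d = enat (1 + t * (d - (t - 3) div 2))"
proof -
  define q D where "q = (t - 3) div 2" and "D = d - q"
  have t: "t = 2 * q + 3" and "q \<ge> 1" using assms(1,2) unfolding q_def by presburger+
  have "d = D + q" and "q \<le> D" using assms(3) t by (auto simp: D_def)
  have coloring_iff: "distance_coloring (G t) d k f \<longleftrightarrow>
      range f \<subseteq> {1..k} \<and> separates_differences (l1_combinations 2 (int t) (D + q)) f" for k f
    using t unfolding G_def \<open>d = D + q\<close>
    by (intro distance_coloring_integer_distance_graph_iff) auto
  have "distance_chromatic_number (G t) d = enat (1 + t * D)"
  proof (rule distance_chromatic_number_eqI)
    have "separates_differences (l1_combinations 2 (int t) (D + q)) (residue_coloring (1 + t * D))"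
      using dvd_l1_combination_imp_zero[OF t \<open>q \<le> D\<close>]
      by (intro separates_differences_residue_coloring) auto
    then show "distance_coloring (G t) d (1 + t * D) (residue_coloring (1 + t * D))"
      unfolding coloring_iff using range_residue_coloring by simp
    show "1 + t * D \<le> k" if "distance_coloring (G t) d k f" for k f
      using separates_l1_combinations_card_ge[OF t \<open>q \<ge> 1\<close> \<open>q \<le> D\<close>, of f "{1..k}"] that
      unfolding coloring_iff by simp
  qed
  then show ?thesis by (simp add: D_def q_def)
qed

end
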